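(* Let $n\ge2$, $m\ge1$, let $D\subset\mathbb{R}^n$ be a bounded Lipschitz domain, let $F$ satisfy the structural assumptions listed in the context, and let $\mathbf{u}$ be a solution of $\Delta\mathbf{u}=f(|\mathbf{u}|)\frac{\mathbf{u}}{|\mathbf{u}|}\chi_{\{|\mathbf{u}|>0\}}$ in $D$. If $x^0\in\overline{\{|\mathbf{u}|>0\}}$ and $B_r(x^0)\subset D$, then $$\sup_{B_r(x^0)}|\mathbf{u}|\ge\frac{f(0)}{2n}r^2.$$
   Context: Assumptions on $F$: $F\in C^{2,\alpha}([0,\infty))$ for some $\alpha\in(0,1)$, $F(0)=0$, and with $f:=\frac12F'$ there are constants $c_0,C_0>0$ with $c_0\le f(s)\le C_0$ and $0\le F''(s)\le C_0$ for all $s\ge0$. A solution is a function $\mathbf{u}\in W^{1,2}(D;\mathbb{R}^m)$ satisfying the system weakly; such $\mathbf{u}$ belongs to $W^{2,p}_{loc}\cap C^{1,\alpha'}_{loc}$ for all $p<\infty$, $\alpha'\in(0,1)$, and the $C^{1}$ representative is used. *)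

theory Defs
  imports "HOL-Analysis.Analysis"
begin

text \<open>\<open>Ck_on k S f\<close> is meant for open \<open>S\<close>; in finite dimension, continuity of all directional
  derivatives is continuity of the derivative.\<close>

primrec Ck_on :: "nat \<Rightarrow> 'a::euclidean_space set \<Rightarrow> ('a \<Rightarrow> 'b::euclidean_space) \<Rightarrow> bool" where
  "Ck_on 0 S f \<longleftrightarrow> continuous_on S f"
| "Ck_on (Suc k) S f \<longleftrightarrow>
     (\<forall>x\<in>S. f differentiable (at x)) \<and>
     (\<forall>v. Ck_on k S (\<lambda>x. frechet_derivative f (at x) v))"

definition test_functions :: "'a::euclidean_space set \<Rightarrow> ('a \<Rightarrow> 'b::euclidean_space) set" where
  "test_functions D = {\<phi>. (\<forall>k. Ck_on k UNIV \<phi>) \<and>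
      compact (closure {x. \<phi> x \<noteq> 0}) \<and> closure {x. \<phi> x \<noteq> 0} \<subseteq> D}"

text \<open>Near each boundary point, \<open>D\<close> is the strict epigraph of a Lipschitz function \<open>\<gamma>\<close> over the
  hyperplane orthogonal to a unit vector \<open>\<nu>\<close>, in coordinates centred at that point.\<close>

definition bounded_Lipschitz_domain :: "'a::euclidean_space set \<Rightarrow> bool" where
  "bounded_Lipschitz_domain D \<longleftrightarrow>
     open D \<and> connected D \<and> D \<noteq> {} \<and> bounded D \<and>
     (\<forall>p\<in>frontier D. \<exists>\<rho>>0. \<exists>\<nu>. norm \<nu> = 1 \<and>
        (\<exists>\<gamma> :: 'a \<Rightarrow> real. (\<exists>L. L-lipschitz_on {y. y \<bullet> \<nu> = 0} \<gamma>) \<and>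
           D \<inter> ball p \<rho> =
             {x \<in> ball p \<rho>. (x - p) \<bullet> \<nu> > \<gamma> ((x - p) - ((x - p) \<bullet> \<nu>) *\<^sub>R \<nu>)}))"

definition L2_on :: "'a::euclidean_space set \<Rightarrow> ('a \<Rightarrow> 'b::euclidean_space) \<Rightarrow> bool" where
  "L2_on D u \<longleftrightarrow> u \<in> borel_measurable (lebesgue_on D) \<and>
     integrable (lebesgue_on D) (\<lambda>x. (norm (u x))\<^sup>2)"

text \<open>Row \<open>i\<close> of the matrix \<open>G x\<close> is the weak gradient of the \<open>i\<close>-th component of \<open>u\<close>.\<close>

definition weak_gradient_on ::
  "(real^'n) set \<Rightarrow> (real^'n \<Rightarrow> real^'m) \<Rightarrow> (real^'n \<Rightarrow> real^'n^'m) \<Rightarrow> bool" where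
  "weak_gradient_on D u G \<longleftrightarrow>
     (\<forall>\<phi> \<in> test_functions D. \<forall>i j.
        integral\<^sup>L (lebesgue_on D) (\<lambda>x. u x $ i * frechet_derivative \<phi> (at x) (axis j 1)) =
        - integral\<^sup>L (lebesgue_on D) (\<lambda>x. G x $ i $ j * \<phi> x))"

definition W12_with_gradient ::
  "(real^'n) set \<Rightarrow> (real^'n \<Rightarrow> real^'m) \<Rightarrow> (real^'n \<Rightarrow> real^'n^'m) \<Rightarrow> bool" where
  "W12_with_gradient D u G \<longleftrightarrow> L2_on D u \<and> L2_on D G \<and> weak_gradient_on D u G"

text \<open>Derivative on \<open>[0,\<infinity>)\<close>, one-sided at \<open>0\<close>; values of \<open>g\<close> at negative arguments play no role.\<close>

definition hderiv :: "(real \<Rightarrow> real) \<Rightarrow> real \<Rightarrow> real" where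
  "hderiv g s = vector_derivative g (at s within {0..})"

text \<open>The Hoelder condition is required on bounded subintervals: under the structural assumptions
  \<open>F\<close> is unbounded, so a globally finite Hoelder norm cannot be meant.\<close>

definition C2_Hoelder :: "real \<Rightarrow> (real \<Rightarrow> real) \<Rightarrow> bool" where
  "C2_Hoelder \<alpha> F \<longleftrightarrow>
     F differentiable_on {0..} \<and> hderiv F differentiable_on {0..} \<and>
     (\<forall>R>0. \<exists>H. \<forall>s\<in>{0..R}. \<forall>t\<in>{0..R}.
        \<bar>hderiv (hderiv F) s - hderiv (hderiv F) t\<bar> \<le> H * \<bar>s - t\<bar> powr \<alpha>)"

definition half_deriv :: "(real \<Rightarrow> real) \<Rightarrow> real \<Rightarrow> real" where
  "half_deriv F s = hderiv F s / 2"

definition structural_assumptions :: "(real \<Rightarrow> real) \<Rightarrow> bool" where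
  "structural_assumptions F \<longleftrightarrow>
     (\<exists>\<alpha>. 0 < \<alpha> \<and> \<alpha> < 1 \<and> C2_Hoelder \<alpha> F) \<and> F 0 = 0 \<and>
     (\<exists>c\<^sub>0>0. \<exists>C\<^sub>0>0. \<forall>s\<ge>0.
        c\<^sub>0 \<le> half_deriv F s \<and> half_deriv F s \<le> C\<^sub>0 \<and>
        0 \<le> hderiv (hderiv F) s \<and> hderiv (hderiv F) s \<le> C\<^sub>0)"

definition system_rhs ::
  "(real \<Rightarrow> real) \<Rightarrow> (real^'n \<Rightarrow> real^'m) \<Rightarrow> real^'n \<Rightarrow> real^'m" where
  "system_rhs f u x =
     indicator {y. norm (u y) > 0} x *\<^sub>R (f (norm (u x)) *\<^sub>R (u x /\<^sub>R norm (u x)))"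

text \<open>The inner product of matrices is the Frobenius one, so the left-hand integrand is
  \<open>\<nabla>u : \<nabla>\<phi>\<close>.\<close>

definition weak_solution ::
  "(real^'n) set \<Rightarrow> (real \<Rightarrow> real) \<Rightarrow> (real^'n \<Rightarrow> real^'m) \<Rightarrow> bool" where
  "weak_solution D f u \<longleftrightarrow>
     (\<exists>G. W12_with_gradient D u G \<and>
        (\<forall>\<phi> \<in> test_functions D.
           integral\<^sup>L (lebesgue_on D) (\<lambda>x. G x \<bullet> matrix (frechet_derivative \<phi> (at x))) =
           - integral\<^sup>L (lebesgue_on D) (\<lambda>x. system_rhs f u x \<bullet> \<phi> x)))"

definition C1_representative ::
  "(real^'n) set \<Rightarrow> (real^'n \<Rightarrow> real^'m) \<Rightarrow> (real^'n \<Rightarrow> real^'m) \<Rightarrow> bool" where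
  "C1_representative D w u \<longleftrightarrow> Ck_on 1 D u \<and> (AE x in lebesgue_on D. u x = w x)"

end

theory Submission
  imports Defs
begin

text \<open>Fix \<open>y\<close> near \<open>x\<^sup>0\<close> with \<open>u(y) \<noteq> 0\<close> and suppose \<open>|u| < c s\<^sup>2\<close> on \<open>B\<^sub>s(y)\<close>. Then
  \<open>|u| - c|x - y|\<^sup>2\<close> attains its positive maximum over the closed ball at an interior point
  \<open>x\<^sub>1\<close>, where \<open>u(x\<^sub>1) \<noteq> 0\<close>. With \<open>e = u(x\<^sub>1)/|u(x\<^sub>1)|\<close>, the scalar function \<open>v = u \<bullet> e \<le> |u|\<close>
  agrees with \<open>|u|\<close> at \<open>x\<^sub>1\<close>, so it is touched there from above by a translate of \<open>c|x - y|\<^sup>2\<close>.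
  Near \<open>x\<^sub>1\<close> one has \<open>\<Delta>v = f(|u|) (u \<bullet> e)/|u| \<ge> \<theta> f(0)\<close> weakly for any \<open>\<theta> < 1\<close>, because
  \<open>f\<close> is nondecreasing; hence \<open>\<theta> f(0) \<le> 2nc\<close>. Linearising at the touching point in this way
  avoids computing \<open>\<Delta>|u|\<close>.\<close>

subsection \<open>Smooth compactly supported functions\<close>

text \<open>\<open>Ck_on\<close> recurses through \<open>frechet_derivative\<close>; uniqueness of
  derivatives lets an explicit derivative \<open>f'\<close> stand in for it, so the closure
  properties can be proved by induction on \<open>k\<close>.\<close>

lemma Ck_on_UNIV_SucI:
  assumes "\<And>x. (f has_derivative f' x) (at x)" and "\<And>v. Ck_on k UNIV (\<lambda>x. f' x v)"
  shows "Ck_on (Suc k) UNIV f"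
proof -
  have "frechet_derivative f (at x) = f' x" for x
    using assms(1) frechet_derivative_at by metis
  then show ?thesis
    using assms by (auto simp: differentiable_def)
qed

lemma Ck_on_Suc_has_derivative:
  assumes "Ck_on (Suc k) UNIV f"
  shows "(f has_derivative frechet_derivative f (at x)) (at x)"
  using assms by (simp add: frechet_derivative_works)

lemma Ck_on_SucD: "Ck_on (Suc k) UNIV f \<Longrightarrow> Ck_on k UNIV f"
proof (induction k arbitrary: f)
  case 0
  then show ?case
    by (auto intro!: continuous_at_imp_continuous_on differentiable_imp_continuous_within)
next
  case (Suc k)
  then show ?case by auto
qed

lemma Ck_on_const: "Ck_on k UNIV (\<lambda>x. c)"
proof (induction k arbitrary: c)
  case (Suc k)
  show ?case
    by (rule Ck_on_UNIV_SucI[OF has_derivative_const]) (rule Suc)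
qed simp

lemma Ck_on_add:
  "Ck_on k UNIV f \<Longrightarrow> Ck_on k UNIV g \<Longrightarrow> Ck_on k UNIV (\<lambda>x. f x + g x)"
proof (induction k arbitrary: f g)
  case 0
  then show ?case by (auto intro: continuous_intros)
next
  case (Suc k)
  show ?case
    by (rule Ck_on_UNIV_SucI[OF has_derivative_add
          [OF Ck_on_Suc_has_derivative[OF Suc.prems(1)] Ck_on_Suc_has_derivative[OF Suc.prems(2)]]])
      (use Suc in auto)
qed

lemma Ck_on_scaleR:
  fixes f :: "'a::euclidean_space \<Rightarrow> real"
  shows "Ck_on k UNIV f \<Longrightarrow> Ck_on k UNIV g \<Longrightarrow> Ck_on k UNIV (\<lambda>x. f x *\<^sub>R g x)"
proof (induction k arbitrary: f g)
  case 0
  then show ?case by (auto intro: continuous_intros)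
next
  case (Suc k)
  have "Ck_on k UNIV (\<lambda>x. frechet_derivative f (at x) v)"
    "Ck_on k UNIV (\<lambda>x. frechet_derivative g (at x) v)" for v
    using Suc.prems by simp_all
  then have "Ck_on k UNIV (\<lambda>x. f x *\<^sub>R frechet_derivative g (at x) v
      + frechet_derivative f (at x) v *\<^sub>R g x)" for v
    by (intro Ck_on_add Suc.IH Ck_on_SucD[OF Suc.prems(1)] Ck_on_SucD[OF Suc.prems(2)])
  then show ?case
    by (rule Ck_on_UNIV_SucI[OF has_derivative_scaleR
          [OF Ck_on_Suc_has_derivative[OF Suc.prems(1)] Ck_on_Suc_has_derivative[OF Suc.prems(2)]]])
qed

lemma Ck_on_bounded_linear:
  assumes "bounded_linear f"
  shows "Ck_on k UNIV f"
proof (cases k)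
  case 0
  then show ?thesis using assms by (simp add: linear_continuous_on)
next
  case (Suc l)
  show ?thesis unfolding Suc
    by (rule Ck_on_UNIV_SucI[OF bounded_linear.has_derivative[OF assms has_derivative_ident]])
      (rule Ck_on_const)
qed

text \<open>The prefactor \<open>p(1/t)\<close> makes the family closed under differentiation.\<close>

definition flat :: "real poly \<Rightarrow> real \<Rightarrow> real" where
  "flat p t = (if t \<le> 0 then 0 else poly p (1 / t) * exp (- (1 / t)))"

lemma poly_times_exp_minus_tendsto_0:
  fixes p :: "real poly"
  shows "((\<lambda>y. poly p y * exp (- y)) \<longlongrightarrow> 0) at_top"
proof -
  have "((\<lambda>y. \<Sum>i\<le>degree p. coeff p i * (y ^ i / exp y)) \<longlongrightarrow> (\<Sum>i\<le>degree p. coeff p i * 0)) at_top"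
    by (intro tendsto_sum tendsto_mult tendsto_const tendsto_power_div_exp_0)
  then show ?thesis
    by (simp add: poly_altdef sum_distrib_right exp_minus divide_inverse mult.assoc)
qed

text \<open>For t > 0 the chain rule produces (p - p')(1/t) exp(-1/t) times t^-2, and t^-2 is the
  polynomial \<open>monom 1 2\<close> evaluated at 1/t. At the origin exponential decay beats every
  power.\<close>

lemma flat_has_real_derivative:
  "(flat p has_real_derivative flat (monom 1 2 * (p - pderiv p)) t) (at t)"
proof -
  consider "t < 0" | "t = 0" | "t > 0" by linarith
  then show ?thesis
  proof cases
    case 1
    have "((\<lambda>_. 0) has_real_derivative 0) (at t)" by simp
    then have "(flat p has_real_derivative 0) (at t)"
      by (rule has_field_derivative_transform_within_open[where S = "{..<0}"])
        (use 1 in \<open>auto simp: flat_def\<close>)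
    then show ?thesis using 1 by (simp add: flat_def)
  next
    case 2
    have "((\<lambda>h. flat p h / h) \<longlongrightarrow> 0) (at 0)"
    proof (rule filterlim_split_at)
      have "((\<lambda>h. 0) \<longlongrightarrow> 0) (at_left (0::real))" by simp
      then show "((\<lambda>h. flat p h / h) \<longlongrightarrow> 0) (at_left 0)"
        by (rule Lim_transform_eventually)
          (auto simp: flat_def eventually_at_left_field intro!: exI[of _ "-1"])
    next
      \<comment> \<open>With y = 1/h the right-hand difference quotient at 0 is y p(y) exp(-y),
        hence the extra factor \<open>monom 1 1\<close>.\<close>
      have "((\<lambda>y. poly (monom 1 1 * p) y * exp (- y)) \<longlongrightarrow> 0) at_top"
        by (rule poly_times_exp_minus_tendsto_0)
      then have "((\<lambda>h. poly (monom 1 1 * p) (inverse h) * exp (- inverse h)) \<longlongrightarrow> 0) (at_right 0)"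
        using filterlim_compose filterlim_inverse_at_top_right by blast
      then show "((\<lambda>h. flat p h / h) \<longlongrightarrow> 0) (at_right 0)"
        by (rule Lim_transform_eventually)
          (auto simp: flat_def eventually_at_right_field poly_monom field_simps intro!: exI[of _ "1"])
    qed
    then show ?thesis using 2 by (simp add: DERIV_def flat_def)
  next
    case 3
    have "((\<lambda>t. poly p (1 / t) * exp (- (1 / t))) has_real_derivative
        flat (monom 1 2 * (p - pderiv p)) t) (at t)"
      using 3 by (auto simp: flat_def poly_monom field_simps power2_eq_square
          intro!: derivative_eq_intros DERIV_chain'[OF _ poly_DERIV, THEN DERIV_cong])
    then show ?thesis
      by (rule has_field_derivative_transform_within_open[where S = "{0<..}"])
        (use 3 in \<open>auto simp: flat_def\<close>)
  qed
qed

text \<open>The standard mollifier exp(-1/(e^2 - |x - a|^2)) before normalisation. The inner product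
  keeps the argument of \<open>flat\<close> visibly polynomial in \<open>x\<close>, also at the
  centre.\<close>

definition bump :: "real \<Rightarrow> 'a::euclidean_space \<Rightarrow> 'a \<Rightarrow> real" where
  "bump e a x = flat 1 (e\<^sup>2 - (x - a) \<bullet> (x - a))"

text \<open>The polynomial is arbitrary because each directional derivative is again of this form,
  with another polynomial, times an affine function of \<open>x\<close>; the case
  \<open>p = 1\<close> is \<open>bump\<close>.\<close>

lemma Ck_on_flat_bump: "Ck_on k UNIV (\<lambda>x. flat p (e\<^sup>2 - (x - a) \<bullet> (x - a)))"
proof (induction k arbitrary: p)
  case 0
  have "continuous_on UNIV (flat p)"
    by (intro continuous_at_imp_continuous_on ballI DERIV_isCont[OF flat_has_real_derivative])
  then have "continuous_on UNIV (\<lambda>x. flat p (e\<^sup>2 - (x - a) \<bullet> (x - a)))"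
    by (rule continuous_on_compose2) (auto intro!: continuous_intros)
  then show ?case by simp
next
  case (Suc k)
  let ?q = "monom 1 2 * (p - pderiv p)"
  have d: "((\<lambda>x. flat p (e\<^sup>2 - (x - a) \<bullet> (x - a))) has_derivative
     (\<lambda>v. flat ?q (e\<^sup>2 - (x - a) \<bullet> (x - a)) *\<^sub>R (x \<bullet> (- 2 *\<^sub>R v) + a \<bullet> (2 *\<^sub>R v)))) (at x)" for x
  proof -
    have "((\<lambda>x. e\<^sup>2 - (x - a) \<bullet> (x - a)) has_derivative (\<lambda>v. x \<bullet> (- 2 *\<^sub>R v) + a \<bullet> (2 *\<^sub>R v))) (at x)"
      by (auto intro!: derivative_eq_intros simp: inner_commute algebra_simps)
    from has_derivative_compose[OF this
        flat_has_real_derivative[of p, unfolded has_field_derivative_def]]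
    show ?thesis by simp
  qed
  show ?case
    by (rule Ck_on_UNIV_SucI[OF d])
      (intro Ck_on_scaleR Ck_on_add Suc.IH Ck_on_const Ck_on_bounded_linear bounded_linear_inner_left)
qed

lemma bump_nonneg: "0 \<le> bump e a x"
  by (simp add: bump_def flat_def)

lemma bump_pos: "0 < e \<Longrightarrow> dist x a < e \<Longrightarrow> 0 < bump e a x"
  using power_strict_mono[of "dist x a" e 2]
  by (simp add: bump_def flat_def dist_norm power2_norm_eq_inner)

lemma bump_eq_0: "0 < e \<Longrightarrow> e \<le> dist x a \<Longrightarrow> bump e a x = 0"
  using power_mono[of e "dist x a" 2]
  by (simp add: bump_def flat_def dist_norm power2_norm_eq_inner)

lemma bump_le_1: "bump e a x \<le> 1"
  by (simp add: bump_def flat_def)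

lemma bump_commute: "bump e a x = bump e x a"
  by (simp add: bump_def inner_diff_left inner_diff_right inner_commute algebra_simps)

lemma bump_translate: "bump e (a + h) x = bump e a (x - h)"
  by (simp add: bump_def algebra_simps)

lemma bump_test_function:
  assumes "0 < e" "cball a e \<subseteq> D"
  shows "bump e a \<in> test_functions D"
proof -
  have "Ck_on k UNIV (bump e a)" for k
    using Ck_on_flat_bump[of k 1 e a] by (simp add: bump_def[abs_def])
  moreover have "closure {x. bump e a x \<noteq> 0} \<subseteq> cball a e"
  proof (rule closure_minimal)
    show "{x. bump e a x \<noteq> 0} \<subseteq> cball a e"
      using bump_eq_0[OF assms(1), of _ a] by (force simp: dist_commute)
  qed simp
  moreover from this have "compact (closure {x. bump e a x \<noteq> 0})"
    using compact_Int_closed[OF compact_cball[of a e] closed_closure[of "{x. bump e a x \<noteq> 0}"]]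
    by (simp only: Int_absorb1)
  ultimately show ?thesis
    using assms(2) by (auto simp: test_functions_def)
qed

section \<open>Derivatives and bounds of test functions\<close>

lemma test_functionD:
  assumes "\<phi> \<in> test_functions D"
  shows "Ck_on k UNIV \<phi>" "compact (closure {x. \<phi> x \<noteq> 0})" "closure {x. \<phi> x \<noteq> 0} \<subseteq> D"
  using assms unfolding test_functions_def by blast+

lemma test_function_eq_0: "\<phi> \<in> test_functions D \<Longrightarrow> x \<notin> D \<Longrightarrow> \<phi> x = 0"
  using test_functionD(3)[of \<phi> D] closure_subset[of "{x. \<phi> x \<noteq> 0}"] by blast

lemma test_functions_mono: "D \<subseteq> E \<Longrightarrow> test_functions D \<subseteq> test_functions E"
  unfolding test_functions_def by blast

lemma test_function_has_derivative:
  assumes "\<phi> \<in> test_functions D"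
  shows "(\<phi> has_derivative frechet_derivative \<phi> (at x)) (at x)"
  by (rule Ck_on_Suc_has_derivative[OF test_functionD(1)[OF assms, of "Suc 0"]])

lemma test_function_continuous_on:
  assumes "\<phi> \<in> test_functions D"
  shows "continuous_on A \<phi>"
  using test_functionD(1)[OF assms, of 0] continuous_on_subset[of UNIV \<phi>] by simp

text \<open>A test function vanishes on the open complement of its closed support, so its derivative
  does too and the support does not grow. Hence test functions can be differentiated
  repeatedly.\<close>

lemma frechet_derivative_test_function:
  assumes "\<phi> \<in> test_functions D"
  shows "(\<lambda>x. frechet_derivative \<phi> (at x) v) \<in> test_functions D"
proof -
  let ?K = "closure {x. \<phi> x \<noteq> 0}"
  let ?d = "\<lambda>x. frechet_derivative \<phi> (at x) v"
  have 0: "?d x = 0" if "x \<notin> ?K" for x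
  proof -
    have "((\<lambda>x. 0) has_derivative (\<lambda>v. 0)) (at x)" by simp
    then have "(\<phi> has_derivative (\<lambda>v. 0)) (at x)"
      by (rule has_derivative_transform_within_open[where s = "- ?K"])
        (use that closure_subset[of "{x. \<phi> x \<noteq> 0}"] in auto)
    then show ?thesis using frechet_derivative_at by metis
  qed
  then have "closure {x. ?d x \<noteq> 0} \<subseteq> ?K"
    by (intro closure_minimal) auto
  then have "closure {x. ?d x \<noteq> 0} \<subseteq> D" "compact (closure {x. ?d x \<noteq> 0})"
    using test_functionD(3)[OF assms]
      compact_Int_closed[OF test_functionD(2)[OF assms] closed_closure[of "{x. ?d x \<noteq> 0}"]]
    by (blast, simp only: Int_absorb1)
  moreover have "Ck_on k UNIV ?d" for k
    using test_functionD(1)[OF assms, of "Suc k"] by simp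
  ultimately show ?thesis
    unfolding test_functions_def by blast
qed

lemma test_function_bounded:
  assumes "\<phi> \<in> test_functions D"
  shows "\<exists>M>0. \<forall>x. norm (\<phi> x) \<le> M"
proof -
  let ?K = "closure {x. \<phi> x \<noteq> 0}"
  have "compact (\<phi> ` ?K)"
    by (intro compact_continuous_image test_function_continuous_on[OF assms] test_functionD(2)[OF assms])
  then obtain M where M: "M > 0" "\<forall>y\<in>\<phi> ` ?K. norm y \<le> M"
    using compact_imp_bounded bounded_pos[of "\<phi> ` ?K"] by blast
  have "norm (\<phi> x) \<le> M" for x
  proof (cases "\<phi> x = 0")
    case False
    then have "x \<in> ?K" using closure_subset[of "{x. \<phi> x \<noteq> 0}"] by blast
    then show ?thesis using M(2) by blast
  qed (use M(1) in simp)
  with M(1) show ?thesis by blast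
qed

subsection \<open>Second differences and mollification\<close>

definition laplacian :: "(real^'n \<Rightarrow> real) \<Rightarrow> real^'n \<Rightarrow> real" where
  "laplacian \<phi> x = (\<Sum>j\<in>UNIV.
     frechet_derivative (\<lambda>y. frechet_derivative \<phi> (at y) (axis j 1)) (at x) (axis j 1))"

lemma test_function_line_derivative:
  fixes \<phi> :: "'a::euclidean_space \<Rightarrow> real"
  assumes "\<phi> \<in> test_functions D"
  shows "((\<lambda>t. \<phi> (z + t *\<^sub>R e)) has_real_derivative frechet_derivative \<phi> (at (z + t *\<^sub>R e)) e) (at t)"
proof -
  let ?d = "frechet_derivative \<phi> (at (z + t *\<^sub>R e))"
  have d: "(\<phi> has_derivative ?d) (at (z + t *\<^sub>R e))"
    using assms by (rule test_function_has_derivative)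
  have "((\<lambda>t. z + t *\<^sub>R e) has_derivative (\<lambda>s. s *\<^sub>R e)) (at t)"
    by (auto intro!: derivative_eq_intros)
  from has_derivative_compose[OF this d]
  have "((\<lambda>t. \<phi> (z + t *\<^sub>R e)) has_derivative (\<lambda>s. ?d (s *\<^sub>R e))) (at t)" .
  moreover have "(\<lambda>s. ?d (s *\<^sub>R e)) = (*) (?d e)"
    using linear_scale[OF has_derivative_linear[OF d]] by (auto simp: mult.commute)
  ultimately show ?thesis
    by (simp add: has_field_derivative_def)
qed

text \<open>The even function t -> \<phi>(z + te) + \<phi>(z - te) has zero derivative at 0, so its
  Taylor formula of order two has no linear term. The Lagrange remainder expresses the quotient by
  values of the second derivative, which bounds it uniformly in \<open>z\<close> and
  \<open>h\<close>.\<close>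

lemma test_function_second_difference:
  fixes \<phi> :: "'a::euclidean_space \<Rightarrow> real" and e :: 'a
  defines "d \<equiv> \<lambda>y. frechet_derivative (\<lambda>y. frechet_derivative \<phi> (at y) e) (at y) e"
  assumes \<phi>: "\<phi> \<in> test_functions D" and h: "0 < h"
  shows "\<exists>t. 0 < t \<and> t < h \<and>
    (\<phi> (z + h *\<^sub>R e) + \<phi> (z - h *\<^sub>R e) - 2 * \<phi> z) / h\<^sup>2 = (d (z + t *\<^sub>R e) + d (z - t *\<^sub>R e)) / 2"
proof -
  let ?d1 = "\<lambda>y. frechet_derivative \<phi> (at y) e"
  have d1: "((\<lambda>t. \<phi> (z + t *\<^sub>R e)) has_real_derivative ?d1 (z + t *\<^sub>R e)) (at t)" for z t
    using \<phi> by (rule test_function_line_derivative)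
  have d2: "((\<lambda>t. ?d1 (z + t *\<^sub>R e)) has_real_derivative d (z + t *\<^sub>R e)) (at t)" for z t
    unfolding d_def
    using frechet_derivative_test_function[OF \<phi>] by (rule test_function_line_derivative)
  have m1: "((\<lambda>t. \<phi> (z - t *\<^sub>R e)) has_real_derivative - ?d1 (z - t *\<^sub>R e)) (at t)" for t
    using DERIV_mirror[THEN iffD1, of "\<lambda>t. \<phi> (z + t *\<^sub>R e)", OF d1[of z "- t"]] by simp
  have m2: "((\<lambda>t. ?d1 (z - t *\<^sub>R e)) has_real_derivative - d (z - t *\<^sub>R e)) (at t)" for t
    using DERIV_mirror[THEN iffD1, of "\<lambda>t. ?d1 (z + t *\<^sub>R e)", OF d2[of z "- t"]] by simp
  define k where "k = (\<lambda>m::nat. if m = 0 then (\<lambda>t. \<phi> (z + t *\<^sub>R e) + \<phi> (z - t *\<^sub>R e))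
     else if m = 1 then (\<lambda>t. ?d1 (z + t *\<^sub>R e) - ?d1 (z - t *\<^sub>R e))
     else (\<lambda>t. d (z + t *\<^sub>R e) + d (z - t *\<^sub>R e)))"
  have "DERIV (k 0) t :> k (Suc 0) t" for t
    using DERIV_add[OF d1 m1] by (simp add: k_def)
  moreover have "DERIV (k (Suc 0)) t :> k (Suc (Suc 0)) t" for t
    using DERIV_diff[OF d2 m2] by (simp add: k_def)
  ultimately have "DERIV (k m) t :> k (Suc m) t" if "m < 2" for m t
    using that by (auto simp: less_2_cases_iff)
  then obtain t where "0 < t" "t < h"
    "k 0 h = (\<Sum>m<2. (k m 0 / fact m) * h ^ m) + (k 2 t / fact 2) * h ^ 2"
    using Maclaurin[OF h, of 2 k "k 0"] by auto
  then show ?thesis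
    using h by (intro exI[of _ t]) (simp add: k_def lessThan_Suc numeral_2_eq_2 field_simps)
qed

text \<open>\<open>V\<close> is merely integrable, so the difference quotients fall on the smooth
  factor. They converge pointwise to the second derivative and obey any bound for it, so a constant
  multiple of |V| dominates.\<close>

lemma integral_second_difference_tendsto:
  fixes \<phi> V :: "'a::euclidean_space \<Rightarrow> real" and e :: 'a
  defines "d \<equiv> \<lambda>y. frechet_derivative (\<lambda>y. frechet_derivative \<phi> (at y) e) (at y) e"
  assumes \<phi>: "\<phi> \<in> test_functions D" and V: "integrable lborel V"
    and h: "h \<longlonglongrightarrow> 0" "\<And>k. 0 < h k"
  shows "(\<lambda>k. \<integral>z. V z * ((\<phi> (z + h k *\<^sub>R e) + \<phi> (z - h k *\<^sub>R e) - 2 * \<phi> z) / (h k)\<^sup>2) \<partial>lborel)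
    \<longlonglongrightarrow> (\<integral>z. V z * d z \<partial>lborel)"
proof -
  have dt: "d \<in> test_functions D"
    unfolding d_def by (intro frechet_derivative_test_function \<phi>)
  obtain M where M: "\<And>x. norm (d x) \<le> M"
    using test_function_bounded[OF dt] by blast
  have [measurable]: "d \<in> borel_measurable borel" "\<phi> \<in> borel_measurable borel"
    using test_function_continuous_on \<phi> dt by (blast intro: borel_measurable_continuous_onI)+
  have [measurable]: "V \<in> borel_measurable borel" using V by auto
  have "\<exists>t. 0 < t \<and> t < h k \<and>
    (\<phi> (z + h k *\<^sub>R e) + \<phi> (z - h k *\<^sub>R e) - 2 * \<phi> z) / (h k)\<^sup>2 =
    (d (z + t *\<^sub>R e) + d (z - t *\<^sub>R e)) / 2" for z k
    unfolding d_def by (rule test_function_second_difference[OF \<phi> h(2)])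
  then have "\<forall>z k. \<exists>t. 0 < t \<and> t < h k \<and>
    (\<phi> (z + h k *\<^sub>R e) + \<phi> (z - h k *\<^sub>R e) - 2 * \<phi> z) / (h k)\<^sup>2 =
    (d (z + t *\<^sub>R e) + d (z - t *\<^sub>R e)) / 2"
    by blast
  \<comment> \<open>The intermediate points are chosen with no measurability in \<open>z\<close>;
    they serve only the pointwise estimates, while the integrand stays a difference
    quotient.\<close>
  from this[unfolded choice_iff] obtain t where t: "\<And>z k. 0 < t z k" "\<And>z k. t z k < h k"
    and eq: "\<And>z k. (\<phi> (z + h k *\<^sub>R e) + \<phi> (z - h k *\<^sub>R e) - 2 * \<phi> z) / (h k)\<^sup>2 =
      (d (z + t z k *\<^sub>R e) + d (z - t z k *\<^sub>R e)) / 2"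
    by blast
  show ?thesis
  proof (rule integral_dominated_convergence[where w = "\<lambda>z. norm (V z) * M"])
    show "integrable lborel (\<lambda>z. norm (V z) * M)" using V by simp
    show "AE z in lborel. (\<lambda>k. V z * ((\<phi> (z + h k *\<^sub>R e) + \<phi> (z - h k *\<^sub>R e) - 2 * \<phi> z) / (h k)\<^sup>2))
      \<longlonglongrightarrow> V z * d z"
    proof (rule AE_I2)
      fix z
      have "t z \<longlonglongrightarrow> 0"
        by (rule tendsto_sandwich[OF _ _ tendsto_const h(1)])
          (use t in \<open>auto intro!: always_eventually less_imp_le\<close>)
      then have "(\<lambda>k. z + t z k *\<^sub>R e) \<longlonglongrightarrow> z + 0 *\<^sub>R e" "(\<lambda>k. z - t z k *\<^sub>R e) \<longlonglongrightarrow> z - 0 *\<^sub>R e"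
        by (intro tendsto_intros; assumption)+
      moreover have "isCont d z"
        using test_function_continuous_on[OF dt, of UNIV] by (simp add: continuous_on_eq_continuous_at)
      ultimately have "(\<lambda>k. d (z + t z k *\<^sub>R e)) \<longlonglongrightarrow> d z" "(\<lambda>k. d (z - t z k *\<^sub>R e)) \<longlonglongrightarrow> d z"
        by (auto intro: isCont_tendsto_compose)
      then have "(\<lambda>k. V z * ((d (z + t z k *\<^sub>R e) + d (z - t z k *\<^sub>R e)) / 2)) \<longlonglongrightarrow> V z * ((d z + d z) / 2)"
        by (intro tendsto_intros) auto
      then show "(\<lambda>k. V z * ((\<phi> (z + h k *\<^sub>R e) + \<phi> (z - h k *\<^sub>R e) - 2 * \<phi> z) / (h k)\<^sup>2))
        \<longlonglongrightarrow> V z * d z"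
        by (simp add: eq)
    qed
    show "AE z in lborel. norm (V z * ((\<phi> (z + h k *\<^sub>R e) + \<phi> (z - h k *\<^sub>R e) - 2 * \<phi> z) / (h k)\<^sup>2))
      \<le> norm (V z) * M" for k
    proof (rule AE_I2)
      fix z
      have "norm ((d (z + t z k *\<^sub>R e) + d (z - t z k *\<^sub>R e)) / 2) \<le> M"
        using M[of "z + t z k *\<^sub>R e"] M[of "z - t z k *\<^sub>R e"] by auto
      then show "norm (V z * ((\<phi> (z + h k *\<^sub>R e) + \<phi> (z - h k *\<^sub>R e) - 2 * \<phi> z) / (h k)\<^sup>2))
        \<le> norm (V z) * M"
        unfolding eq norm_mult by (intro mult_left_mono) auto
    qed
  qed measurable
qed

section \<open>Integrability against test functions\<close>

lemma test_function_borel_measurable: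
  "\<phi> \<in> test_functions D \<Longrightarrow> \<phi> \<in> borel_measurable borel"
  by (intro borel_measurable_continuous_onI test_function_continuous_on)

lemma test_function_integrable_mult:
  fixes \<phi> V :: "'a::euclidean_space \<Rightarrow> real"
  assumes "\<phi> \<in> test_functions D" and V: "integrable M V" and [measurable]: "\<phi> \<in> borel_measurable M"
  shows "integrable M (\<lambda>z. V z * \<phi> z)"
proof -
  obtain B where B: "0 < B" "\<And>x. norm (\<phi> x) \<le> B"
    using test_function_bounded[OF assms(1)] by blast
  have [measurable]: "V \<in> borel_measurable M" using V by auto
  have "integrable M (\<lambda>z. norm (V z) * B)" using V by simp
  then show ?thesis
  proof (rule Bochner_Integration.integrable_bound)
    have "norm (V z * \<phi> z) \<le> norm (norm (V z) * B)" for z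
      using mult_left_mono[OF B(2)[of z], of "norm (V z)"] B(1) by (simp add: abs_mult)
    then show "AE z in M. norm (V z * \<phi> z) \<le> norm (norm (V z) * B)" by simp
  qed measurable
qed

text \<open>Nothing is known about \<open>v\<close> off \<open>D\<close>; the product lives on the
  compact support of \<open>\<phi>\<close>, where \<open>v\<close> is continuous.\<close>

lemma integrable_mult_test_function:
  fixes \<phi> v :: "'a::euclidean_space \<Rightarrow> real"
  assumes "\<phi> \<in> test_functions D" and "continuous_on D v"
  shows "integrable lborel (\<lambda>z. v z * \<phi> z)"
proof -
  let ?K = "closure {x. \<phi> x \<noteq> 0}"
  have "integrable lborel (\<lambda>z. indicator ?K z *\<^sub>R (v z * \<phi> z))"
    by (intro borel_integrable_compact test_functionD(2)[OF assms(1)] continuous_on_mult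
        continuous_on_subset[OF assms(2) test_functionD(3)[OF assms(1)]]
        test_function_continuous_on[OF assms(1)])
  moreover have "(\<lambda>z. indicator ?K z *\<^sub>R (v z * \<phi> z)) = (\<lambda>z. v z * \<phi> z)"
  proof
    fix z show "indicator ?K z *\<^sub>R (v z * \<phi> z) = v z * \<phi> z"
      using closure_subset[of "{x. \<phi> x \<noteq> 0}"] by (auto simp: indicator_def)
  qed
  ultimately show ?thesis by (simp only:)
qed

lemma integrable_test_function:
  fixes \<phi> :: "'a::euclidean_space \<Rightarrow> real"
  assumes "\<phi> \<in> test_functions D"
  shows "integrable lborel \<phi>"
  using integrable_mult_test_function[OF assms, of "\<lambda>_. 1"] by simp

section \<open>Mollification with bumps\<close>

lemma integral_bump_translate:
  fixes a :: "'a::euclidean_space"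
  shows "(\<integral>z. bump e a z \<partial>lborel) = (\<integral>z. bump e (0::'a) z \<partial>lborel)"
proof -
  have [measurable]: "bump e a \<in> borel_measurable borel"
    using Ck_on_flat_bump[of 0 1 e a] by (intro borel_measurable_continuous_onI) (simp add: bump_def[abs_def])
  have "(\<integral>z. bump e a z \<partial>lborel) = (\<integral>z. bump e a z \<partial>(distr lborel borel ((+) a)))"
    by (simp add: lborel_distr_plus)
  also have "\<dots> = (\<integral>z. bump e a (a + z) \<partial>lborel)"
    by (rule integral_distr) measurable
  finally show ?thesis by (simp add: bump_def)
qed

lemma integral_bump_pos:
  assumes "0 < e"
  shows "0 < (\<integral>z. bump e (a::'a::euclidean_space) z \<partial>lborel)"
proof -
  have i: "integrable lborel (bump e a)"
    using bump_test_function[OF assms, of a UNIV] integrable_test_function by blast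
  have "(\<integral>z. bump e a z \<partial>lborel) \<noteq> 0"
  proof
    assume "(\<integral>z. bump e a z \<partial>lborel) = 0"
    then have "AE z in lborel. bump e a z = 0"
      using integral_nonneg_eq_0_iff_AE[OF i] by (simp add: bump_nonneg)
    then have "AE z in lborel. z \<notin> ball a e"
      by eventually_elim (use bump_pos[OF assms, of _ a] in \<open>force simp: dist_commute\<close>)
    then have "emeasure lborel (ball a e) = 0"
      by (subst (asm) AE_iff_measurable[of "ball a e"]) auto
    then show False
      using content_ball_pos[OF assms, of a] by (simp add: measure_def)
  qed
  then show ?thesis
    using Bochner_Integration.integral_nonneg[of lborel "bump e a"] by (simp add: bump_nonneg less_le)
qed

text \<open>By the symmetry \<open>bump_commute\<close>, moving the centre amounts to moving the
  argument of a fixed continuous bump; since bumps lie between 0 and 1, |V| dominates.\<close>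

lemma continuous_on_convolution_bump:
  fixes V :: "'a::euclidean_space \<Rightarrow> real"
  assumes V: "integrable lborel V"
  shows "continuous_on UNIV (\<lambda>x. \<integral>z. V z * bump e x z \<partial>lborel)"
proof (rule continuous_on_sequentiallyI)
  fix X :: "nat \<Rightarrow> 'a" and x assume X: "X \<longlonglongrightarrow> x"
  have c: "continuous_on UNIV (bump e a)" for a :: 'a
    using Ck_on_flat_bump[of 0 1 e a] by (simp add: bump_def[abs_def])
  then have [measurable]: "bump e a \<in> borel_measurable borel" for a :: 'a
    by (rule borel_measurable_continuous_onI)
  have [measurable]: "V \<in> borel_measurable borel" using V by auto
  show "(\<lambda>k. \<integral>z. V z * bump e (X k) z \<partial>lborel) \<longlonglongrightarrow> (\<integral>z. V z * bump e x z \<partial>lborel)"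
  proof (rule integral_dominated_convergence[where w = "\<lambda>z. norm (V z)"])
    show "AE z in lborel. (\<lambda>k. V z * bump e (X k) z) \<longlonglongrightarrow> V z * bump e x z"
    proof (intro AE_I2 tendsto_mult tendsto_const)
      fix z
      have "isCont (bump e z) x" using c[of z] by (simp add: continuous_on_eq_continuous_at)
      then have "(\<lambda>k. bump e z (X k)) \<longlonglongrightarrow> bump e z x" using X by (rule isCont_tendsto_compose)
      then show "(\<lambda>k. bump e (X k) z) \<longlonglongrightarrow> bump e x z" by (simp add: bump_commute[of e z])
    qed
    show "AE z in lborel. norm (V z * bump e (X k) z) \<le> norm (V z)" for k
      using bump_nonneg[of e "X k"] bump_le_1[of e "X k"]
      by (intro AE_I2) (auto simp: abs_mult intro: mult_left_le)
    show "integrable lborel (\<lambda>z. norm (V z))" using V by simp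
  qed measurable
qed

lemma laplacian_eq_0:
  assumes "\<phi> \<in> test_functions D" "x \<notin> D"
  shows "laplacian \<phi> x = 0"
  unfolding laplacian_def
  by (intro sum.neutral ballI test_function_eq_0[OF _ assms(2)] frechet_derivative_test_function assms(1))

text \<open>The strictly convex perturbation \<open>\<kappa>|x - x\<^sub>1|\<^sup>2\<close> keeps the maximum interior after
  mollification of \<open>v\<close>; there the second differences of the mollified function are controlled, and
  they converge to the weak Laplacian tested with the mollifier.\<close>

lemma weak_subsolution_touched_by_paraboloid:
  fixes v :: "real^'n \<Rightarrow> real" and x1 y :: "real^'n"
  assumes \<rho>: "0 < \<rho>" and v: "continuous_on (ball x1 \<rho>) v"
    and touch: "\<And>x. x \<in> ball x1 \<rho> \<Longrightarrow> v x - c * (norm (x - y))\<^sup>2 \<le> v x1 - c * (norm (x1 - y))\<^sup>2"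
    and weak: "\<And>\<phi>. \<phi> \<in> test_functions (ball x1 \<rho>) \<Longrightarrow> (\<And>x. 0 \<le> \<phi> x) \<Longrightarrow>
      a * (\<integral>x. \<phi> x \<partial>lborel) \<le> (\<integral>x. v x * laplacian \<phi> x \<partial>lborel)"
  shows "a \<le> 2 * real CARD('n) * c"
proof (rule field_le_epsilon)
  fix \<eta> :: real assume \<eta>: "0 < \<eta>"
  \<comment> \<open>The perturbation costs \<open>2 * real CARD('n) * \<kappa>\<close> in the final
    bound, which is exactly the allowed slack \<open>\<eta>\<close>.\<close>
  define \<kappa> where "\<kappa> = \<eta> / (2 * real CARD('n))"
  have \<kappa>: "0 < \<kappa>" using \<eta> by (simp add: \<kappa>_def)
  define P where "P x = c * (norm (x - y))\<^sup>2 + \<kappa> * (norm (x - x1))\<^sup>2" for x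
  \<comment> \<open>The maximum is sought within \<open>R\<close> of \<open>x1\<close> and
    mollification reaches at most \<open>R\<close> further, so everything happens in
    \<open>cball x1 (2 * R)\<close>, inside the domain ball.\<close>
  define R where "R = \<rho> / 3"
  have R: "0 < R" using \<rho> by (simp add: R_def)
  define K where "K = cball x1 (2 * R)"
  have KB: "K \<subseteq> ball x1 \<rho>" using \<rho> by (auto simp: K_def R_def)
  have vK: "continuous_on K v" using v KB by (rule continuous_on_subset)
  \<comment> \<open>Cutting \<open>v\<close> off outside \<open>K\<close> makes it globally
    integrable and does not affect mollification at points of \<open>cball x1 R\<close>.\<close>
  define V where "V z = indicator K z *\<^sub>R v z" for z
  have V: "integrable lborel V"
    unfolding V_def using vK by (intro borel_integrable_compact) (simp_all add: K_def)
  \<comment> \<open>Mollification will cost at most \<open>\<tau>\<close> at each of two points, and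
    the total must stay below the gain \<open>\<kappa> * R\<^sup>2\<close> of the perturbation on
    the sphere of radius \<open>R\<close>.\<close>
  define \<tau> where "\<tau> = \<kappa> * R\<^sup>2 / 4"
  have \<tau>: "0 < \<tau>" "2 * \<tau> < \<kappa> * R\<^sup>2" using \<kappa> R by (simp_all add: \<tau>_def)
  have "uniformly_continuous_on K v"
    using vK by (rule compact_uniformly_continuous) (simp add: K_def)
  then obtain \<epsilon>0 where \<epsilon>0: "0 < \<epsilon>0"
    "\<And>x z. x \<in> K \<Longrightarrow> z \<in> K \<Longrightarrow> dist z x < \<epsilon>0 \<Longrightarrow> dist (v z) (v x) < \<tau>"
    using \<tau>(1) unfolding uniformly_continuous_on_def by metis
  define \<epsilon> where "\<epsilon> = min \<epsilon>0 R"
  have \<epsilon>: "0 < \<epsilon>" "\<epsilon> \<le> R" "\<epsilon> \<le> \<epsilon>0" using \<epsilon>0 R by (auto simp: \<epsilon>_def)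
  define m where "m = (\<integral>z. bump \<epsilon> (0::real^'n) z \<partial>lborel)"
  have m: "0 < m" unfolding m_def using \<epsilon>(1) by (rule integral_bump_pos)
  have im: "(\<integral>z. bump \<epsilon> x z \<partial>lborel) = m" for x :: "real^'n"
    unfolding m_def by (rule integral_bump_translate)
  have bt: "bump \<epsilon> x \<in> test_functions UNIV" for x :: "real^'n"
    using \<epsilon>(1) by (rule bump_test_function) simp
  define Q where "Q x = (\<integral>z. V z * bump \<epsilon> x z \<partial>lborel)" for x
  have iQ: "integrable lborel (\<lambda>z. V z * bump \<epsilon> x z)" for x
    by (rule test_function_integrable_mult[OF bt V])
      (use test_function_borel_measurable[OF bt] in simp)
  have sub: "cball x \<epsilon> \<subseteq> K" if "x \<in> cball x1 R" for x
  proof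
    fix z assume "z \<in> cball x \<epsilon>"
    then show "z \<in> K" using that dist_triangle[of x1 z x] \<epsilon>(2) by (simp add: K_def)
  qed
  \<comment> \<open>Where the bump is nonzero, uniform continuity on \<open>K\<close> applies;
    elsewhere both sides are zero. Integrating shows that \<open>Q x / m\<close> is within
    \<open>\<tau>\<close> of \<open>v x\<close>.\<close>
  have pw: "\<bar>V z - v x\<bar> * bump \<epsilon> x z \<le> \<tau> * bump \<epsilon> x z" if x: "x \<in> cball x1 R" for x z
  proof (cases "dist z x < \<epsilon>")
    case True
    then have "z \<in> K" "x \<in> K"
      using sub[OF x] \<epsilon>(1) by (auto simp: dist_commute)
    then have "\<bar>V z - v x\<bar> \<le> \<tau>"
      using \<epsilon>0(2)[of x z] True \<epsilon>(3) by (simp add: V_def dist_real_def)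
    then show ?thesis by (intro mult_right_mono bump_nonneg)
  next
    case False
    then show ?thesis using bump_eq_0[OF \<epsilon>(1), of z x] by simp
  qed
  have upper: "Q x \<le> (v x + \<tau>) * m" if x: "x \<in> cball x1 R" for x
  proof -
    have "Q x \<le> (\<integral>z. (v x + \<tau>) * bump \<epsilon> x z \<partial>lborel)"
      unfolding Q_def
    proof (rule integral_mono[OF iQ])
      fix z
      have "(V z - v x) * bump \<epsilon> x z \<le> \<tau> * bump \<epsilon> x z"
        using pw[OF x, of z] mult_right_mono[OF abs_ge_self[of "V z - v x"] bump_nonneg[of \<epsilon> x z]]
        by linarith
      then show "V z * bump \<epsilon> x z \<le> (v x + \<tau>) * bump \<epsilon> x z" by (simp add: algebra_simps)
    qed (use integrable_test_function[OF bt] in simp)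
    then show ?thesis by (simp add: im)
  qed
  have lower: "(v x - \<tau>) * m \<le> Q x" if x: "x \<in> cball x1 R" for x
  proof -
    have "(\<integral>z. (v x - \<tau>) * bump \<epsilon> x z \<partial>lborel) \<le> Q x"
      unfolding Q_def
    proof (rule integral_mono[OF _ iQ])
      fix z
      have "(v x - V z) * bump \<epsilon> x z \<le> \<tau> * bump \<epsilon> x z"
        using pw[OF x, of z] mult_right_mono[OF abs_ge_minus_self[of "V z - v x"] bump_nonneg[of \<epsilon> x z]]
        by simp
      then show "(v x - \<tau>) * bump \<epsilon> x z \<le> V z * bump \<epsilon> x z" by (simp add: algebra_simps)
    qed (use integrable_test_function[OF bt] in simp)
    then show ?thesis by (simp add: im)
  qed
  define W where "W x = Q x / m - P x" for x
  have "continuous_on UNIV Q"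
    unfolding Q_def by (rule continuous_on_convolution_bump[OF V])
  then have "continuous_on (cball x1 R) W"
    unfolding W_def P_def using m
    by (intro continuous_intros) (auto intro: continuous_on_subset)
  then obtain xs where xs: "xs \<in> cball x1 R" "\<And>x. x \<in> cball x1 R \<Longrightarrow> W x \<le> W xs"
    using continuous_attains_sup[of "cball x1 R" W] R by auto
  \<comment> \<open>On the sphere \<open>P\<close> exceeds the touching paraboloid by
    \<open>\<kappa> * R\<^sup>2\<close>, so \<open>W\<close> is smaller there than at
    \<open>x1\<close> despite the two mollification errors.\<close>
  have "xs \<in> ball x1 R"
  proof (rule ccontr)
    assume "xs \<notin> ball x1 R"
    then have d: "norm (xs - x1) = R" using xs(1) by (simp add: dist_norm norm_minus_commute)
    have "xs \<in> ball x1 \<rho>" using xs(1) R by (simp add: R_def)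
    from touch[OF this] have "W xs \<le> v x1 + \<tau> - c * (norm (x1 - y))\<^sup>2 - \<kappa> * R\<^sup>2"
      using pos_divide_le_eq[OF m, THEN iffD2, OF upper[OF xs(1)]] by (simp add: W_def P_def d)
    also have "\<dots> < v x1 - \<tau> - c * (norm (x1 - y))\<^sup>2" using \<tau>(2) by simp
    also have "\<dots> \<le> W x1"
      using lower[of x1] m R by (simp add: W_def P_def field_simps)
    finally show False using xs(2)[of x1] R by simp
  qed
  then obtain r where r: "0 < r" "ball xs r \<subseteq> ball x1 R"
    using openE open_ball by metis
  \<comment> \<open>The offset 2 makes \<open>h k < r\<close> strict from \<open>k = 0\<close> on,
    so the shifted points stay in \<open>ball xs r\<close>.\<close>
  define h where "h k = r / real (k + 2)" for k
  have h0: "h \<longlonglongrightarrow> 0"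
    unfolding h_def by (rule LIMSEQ_ignore_initial_segment[OF lim_const_over_n])
  have hpos: "0 < h k" for k using r by (simp add: h_def)
  have hr: "h k < r" for k using r(1) by (simp add: h_def divide_less_eq)
  let ?d = "\<lambda>j z. frechet_derivative (\<lambda>y. frechet_derivative (bump \<epsilon> xs) (at y) (axis j 1)) (at z) (axis j 1)"
  \<comment> \<open>At the maximum point of \<open>W\<close> a second difference of
    \<open>Q / m\<close> is at most that of \<open>P\<close>, which is
    \<open>2 * (c + \<kappa>) * (h k)\<^sup>2\<close>; the bound on the quotients passes to the
    limit.\<close>
  have dj: "(\<integral>z. V z * ?d j z \<partial>lborel) \<le> 2 * (c + \<kappa>) * m" for j :: 'n
  proof (rule LIMSEQ_le_const2[OF integral_second_difference_tendsto[OF bt V h0 hpos]], intro exI allI impI)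
    fix k
    let ?e = "axis j 1 :: real^'n"
    let ?b = "bump \<epsilon> xs"
    have "xs + h k *\<^sub>R ?e \<in> ball xs r" "xs - h k *\<^sub>R ?e \<in> ball xs r"
      using hpos[of k] hr[of k] by (simp_all add: dist_norm)
    then have "xs + h k *\<^sub>R ?e \<in> cball x1 R" "xs - h k *\<^sub>R ?e \<in> cball x1 R"
      using subset_trans[OF r(2) ball_subset_cball] by (blast, blast)
    then have W2: "W (xs + h k *\<^sub>R ?e) + W (xs - h k *\<^sub>R ?e) - 2 * W xs \<le> 0"
      using xs(2)[of "xs + h k *\<^sub>R ?e"] xs(2)[of "xs - h k *\<^sub>R ?e"] by simp
    \<comment> \<open>This is the parallelogram law: the second difference of a squared distance is
      the same for every centre \<open>p\<close>, so \<open>y\<close> and \<open>x1\<close> are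
      treated together.\<close>
    have par: "(norm (xs + h k *\<^sub>R ?e - p))\<^sup>2 + (norm (xs - h k *\<^sub>R ?e - p))\<^sup>2
        = 2 * (norm (xs - p))\<^sup>2 + 2 * (h k)\<^sup>2" for p
      unfolding power2_norm_eq_inner
      by (simp add: inner_diff_left inner_diff_right inner_add_left inner_add_right inner_commute
          power2_eq_square inner_axis_axis algebra_simps)
    have "P (xs + h k *\<^sub>R ?e) + P (xs - h k *\<^sub>R ?e) - 2 * P xs = 2 * (c + \<kappa>) * (h k)\<^sup>2"
    proof -
      have "P (xs + h k *\<^sub>R ?e) + P (xs - h k *\<^sub>R ?e)
        = c * ((norm (xs + h k *\<^sub>R ?e - y))\<^sup>2 + (norm (xs - h k *\<^sub>R ?e - y))\<^sup>2)
        + \<kappa> * ((norm (xs + h k *\<^sub>R ?e - x1))\<^sup>2 + (norm (xs - h k *\<^sub>R ?e - x1))\<^sup>2)"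
        by (simp add: P_def distrib_left)
      then show ?thesis unfolding par by (simp add: P_def algebra_simps)
    qed
    with W2 have "(Q (xs + h k *\<^sub>R ?e) + Q (xs - h k *\<^sub>R ?e) - 2 * Q xs) / m \<le> 2 * (c + \<kappa>) * (h k)\<^sup>2"
      by (simp add: W_def add_divide_distrib diff_divide_distrib)
    then have "(Q (xs + h k *\<^sub>R ?e) + Q (xs - h k *\<^sub>R ?e) - 2 * Q xs) / (h k)\<^sup>2 \<le> 2 * (c + \<kappa>) * m"
      using m hpos[of k] by (simp add: divide_le_eq mult.commute mult.left_commute)
    \<comment> \<open>Translating the argument of the bump translates its centre the opposite way,
      so the second difference of the bump integrates to the second difference of
      \<open>Q\<close>.\<close>
    moreover have "(\<integral>z. V z * ((?b (z + h k *\<^sub>R ?e) + ?b (z - h k *\<^sub>R ?e) - 2 * ?b z) / (h k)\<^sup>2) \<partial>lborel)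
      = (Q (xs + h k *\<^sub>R ?e) + Q (xs - h k *\<^sub>R ?e) - 2 * Q xs) / (h k)\<^sup>2"
    proof -
      have tr: "?b (z - h k *\<^sub>R ?e) = bump \<epsilon> (xs + h k *\<^sub>R ?e) z"
        "?b (z + h k *\<^sub>R ?e) = bump \<epsilon> (xs - h k *\<^sub>R ?e) z" for z
        using bump_translate[of \<epsilon> xs "h k *\<^sub>R ?e" z] bump_translate[of \<epsilon> xs "- (h k *\<^sub>R ?e)" z]
        by simp_all
      have split: "V z * ((?b (z + h k *\<^sub>R ?e) + ?b (z - h k *\<^sub>R ?e) - 2 * ?b z) / (h k)\<^sup>2)
        = (V z * bump \<epsilon> (xs + h k *\<^sub>R ?e) z + V z * bump \<epsilon> (xs - h k *\<^sub>R ?e) z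
          - 2 * (V z * bump \<epsilon> xs z)) / (h k)\<^sup>2" for z
        unfolding tr by (simp add: algebra_simps)
      show ?thesis
        unfolding split using iQ by (simp add: Q_def)
    qed
    ultimately show "(\<integral>z. V z * ((?b (z + h k *\<^sub>R ?e) + ?b (z - h k *\<^sub>R ?e) - 2 * ?b z) / (h k)\<^sup>2) \<partial>lborel)
      \<le> 2 * (c + \<kappa>) * m"
      by (simp only:)
  qed
  have bK: "bump \<epsilon> xs \<in> test_functions K"
    using \<epsilon>(1) sub[OF xs(1)] by (rule bump_test_function)
  have "a * m \<le> (\<integral>z. v z * laplacian (bump \<epsilon> xs) z \<partial>lborel)"
    using weak[of "bump \<epsilon> xs"] bK test_functions_mono[OF KB] bump_nonneg by (auto simp: im)
  also have "\<dots> = (\<integral>z. V z * laplacian (bump \<epsilon> xs) z \<partial>lborel)"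
    by (intro Bochner_Integration.integral_cong refl)
      (use laplacian_eq_0[OF bK] in \<open>auto simp: V_def indicator_def\<close>)
  also have "\<dots> = (\<Sum>j\<in>UNIV. \<integral>z. V z * ?d j z \<partial>lborel)"
    unfolding laplacian_def sum_distrib_left
    by (intro Bochner_Integration.integral_sum test_function_integrable_mult[OF _ V, of _ UNIV],
        simp_all add: test_function_borel_measurable[of _ UNIV] frechet_derivative_test_function bt)
  also have "\<dots> \<le> (\<Sum>j\<in>(UNIV::'n set). 2 * (c + \<kappa>) * m)"
    by (intro sum_mono dj)
  finally have "a * m \<le> (2 * real CARD('n) * (c + \<kappa>)) * m" by (simp add: algebra_simps)
  then have "a \<le> 2 * real CARD('n) * (c + \<kappa>)" using m by simp
  then show "a \<le> 2 * real CARD('n) * c + \<eta>" by (simp add: \<kappa>_def distrib_left)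
qed

subsection \<open>The system in scalar form\<close>

text \<open>Nonnegativity of F'' makes f nondecreasing, which is what bounds the right-hand side of
  the system from below in terms of f(0); positivity of f(0) comes from the constant
  \<open>c\<^sub>0\<close>.\<close>

lemma structural_half_deriv:
  assumes "structural_assumptions F"
  shows "continuous_on {0..} (half_deriv F)" and "0 < half_deriv F 0"
    and "0 \<le> s \<Longrightarrow> half_deriv F 0 \<le> half_deriv F s"
proof -
  have d: "hderiv F differentiable_on {0..}"
    using assms by (auto simp: structural_assumptions_def C2_Hoelder_def)
  then have c: "continuous_on {0..} (hderiv F)"
    by (rule differentiable_imp_continuous_on)
  then show "continuous_on {0..} (half_deriv F)"
    unfolding half_deriv_def by (intro continuous_intros) auto
  have pos: "0 \<le> hderiv (hderiv F) t" if "0 \<le> t" for t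
    using assms that by (auto simp: structural_assumptions_def)
  show "0 < half_deriv F 0"
    using assms by (auto simp: structural_assumptions_def intro: less_le_trans)
  show "half_deriv F 0 \<le> half_deriv F s" if "0 \<le> s"
  proof -
    have "hderiv F 0 \<le> hderiv F s"
    proof (rule DERIV_nonneg_imp_increasing_open[OF that])
      fix t :: real assume t: "0 < t" "t < s"
      have "(hderiv F has_vector_derivative hderiv (hderiv F) t) (at t within {0..})"
        using d t unfolding hderiv_def[of "hderiv F"]
        by (simp add: differentiable_on_def vector_derivative_works[symmetric])
      \<comment> \<open>\<open>hderiv\<close> is one-sided only at \<open>0\<close>; at interior
        points it is the ordinary derivative needed by the mean value argument, and the endpoints
        are covered by continuity.\<close>
      moreover have "at t within {0..} = at t"
        using t by (intro at_within_interior) simp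
      ultimately show "\<exists>z. (hderiv F has_real_derivative z) (at t) \<and> 0 \<le> z"
        using pos[of t] t by (auto simp: has_real_derivative_iff_has_vector_derivative)
    qed (use c in \<open>auto intro: continuous_on_subset\<close>)
    then show ?thesis by (simp add: half_deriv_def)
  qed
qed

section \<open>Measurability and integrability of the data\<close>

lemma C1_representative_continuous_on:
  assumes "C1_representative D w u"
  shows "continuous_on D u"
  using assms
  by (auto simp: C1_representative_def intro!: continuous_at_imp_continuous_on
      differentiable_imp_continuous_within)

text \<open>Continuity of \<open>f\<close> is known only on the half-line, so \<open>f\<close> is
  precomposed with \<open>max 0\<close>; norms being nonnegative, \<open>system_rhs\<close> does not
  change.\<close>

lemma borel_measurable_system_rhs:
  assumes f: "continuous_on {0..} f" and [measurable]: "u \<in> borel_measurable M"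
  shows "system_rhs f u \<in> borel_measurable M"
proof -
  have "continuous_on UNIV (\<lambda>t. f (max 0 t))"
    by (rule continuous_on_compose2[OF f]) (auto intro!: continuous_intros)
  then have [measurable]: "(\<lambda>t. f (max 0 t)) \<in> borel_measurable borel"
    by (rule borel_measurable_continuous_onI)
  have "system_rhs f u = (\<lambda>x. (if 0 < norm (u x) then 1 else 0) *\<^sub>R
      ((\<lambda>t. f (max 0 t)) (norm (u x)) *\<^sub>R (u x /\<^sub>R norm (u x))))"
    by (auto simp: system_rhs_def fun_eq_iff indicator_def)
  also have "\<dots> \<in> borel_measurable M"
    by measurable
  finally show ?thesis .
qed

lemma borel_measurable_lebesgue_on:
  "g \<in> borel_measurable borel \<Longrightarrow> g \<in> borel_measurable (lebesgue_on D)"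
  by (intro measurable_restrict_space1 measurable_completion) simp

text \<open>On a bounded domain square-integrable functions are integrable, since t <= 1 + t^2.
  Stating this for any \<open>g\<close> dominated by |u| covers the components of functions and of
  gradients.\<close>

lemma L2_on_integrable:
  assumes "bounded D" "open D" "L2_on D u" and g: "g \<in> borel_measurable (lebesgue_on D)"
    and le: "\<And>x. \<bar>g x\<bar> \<le> norm (u x)"
  shows "integrable (lebesgue_on D) g"
proof (rule Bochner_Integration.integrable_bound[OF _ g])
  have "finite_measure (lebesgue_on D)"
    using assms(1,2) by (intro finite_measure_lebesgue_on bounded_set_imp_lmeasurable) auto
  then have "integrable (lebesgue_on D) (\<lambda>x. 1 :: real)"
    by (simp add: finite_measure.integrable_const)
  then show "integrable (lebesgue_on D) (\<lambda>x. 1 + (norm (u x))\<^sup>2)"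
    using assms(3) by (auto simp: L2_on_def)
  have "\<bar>g x\<bar> \<le> 1 + (norm (u x))\<^sup>2" for x
    using le[of x] sum_squares_bound[of 1 "norm (u x)"] norm_ge_zero[of "u x"]
    by (simp; linarith)
  then show "AE x in lebesgue_on D. norm (g x) \<le> norm (1 + (norm (u x))\<^sup>2)"
    by (auto intro: order_trans[OF _ abs_ge_self])
qed

text \<open>Translates between \<open>lebesgue_on D\<close> of the definitions and
  \<open>lborel\<close> of the mollification argument: the integrand vanishes off \<open>E\<close>,
  and completion does not change integrals of Borel functions.\<close>

lemma integral_lebesgue_on_mult_test_function:
  fixes v \<psi> :: "'a::euclidean_space \<Rightarrow> real"
  assumes "open D" "E \<subseteq> D" "continuous_on E v" "\<psi> \<in> test_functions E"
  shows "(\<integral>x. v x * \<psi> x \<partial>lebesgue_on D) = (\<integral>x. v x * \<psi> x \<partial>lborel)"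
proof -
  have "integrable lborel (\<lambda>x. v x * \<psi> x)"
    by (rule integrable_mult_test_function[OF assms(4,3)])
  then have m: "(\<lambda>x. v x * \<psi> x) \<in> borel_measurable lborel" by auto
  have "(\<integral>x. v x * \<psi> x \<partial>lebesgue_on D) = (\<integral>x. indicator D x *\<^sub>R (v x * \<psi> x) \<partial>lebesgue)"
    using assms(1) by (intro integral_restrict_space) auto
  also have "\<dots> = (\<integral>x. v x * \<psi> x \<partial>lebesgue)"
    by (intro Bochner_Integration.integral_cong refl)
      (use assms(2) test_function_eq_0[OF assms(4)] in \<open>auto simp: indicator_def\<close>)
  also have "\<dots> = (\<integral>x. v x * \<psi> x \<partial>lborel)"
    using m by (rule integral_completion)
  finally show ?thesis .
qed

section \<open>The distributional Laplacian of a component\<close>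

lemma test_function_scaleR_const:
  fixes \<phi> :: "'a::euclidean_space \<Rightarrow> real"
  assumes "\<phi> \<in> test_functions D"
  shows "(\<lambda>x. \<phi> x *\<^sub>R e) \<in> test_functions D"
proof -
  have "closure {x. \<phi> x *\<^sub>R e \<noteq> 0} \<subseteq> closure {x. \<phi> x \<noteq> 0}"
    by (intro closure_mono) auto
  then have "closure {x. \<phi> x *\<^sub>R e \<noteq> 0} \<subseteq> D" "compact (closure {x. \<phi> x *\<^sub>R e \<noteq> 0})"
    using test_functionD(3)[OF assms]
      compact_Int_closed[OF test_functionD(2)[OF assms] closed_closure[of "{x. \<phi> x *\<^sub>R e \<noteq> 0}"]]
    by (blast, simp only: Int_absorb1)
  moreover have "Ck_on k UNIV (\<lambda>x. \<phi> x *\<^sub>R e)" for k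
    by (intro Ck_on_scaleR Ck_on_const test_functionD(1)[OF assms])
  ultimately show ?thesis
    unfolding test_functions_def by blast
qed

text \<open>Testing the system with \<open>\<phi> x *\<^sub>R e\<close> singles out the component
  along \<open>e\<close>, and the weak gradient tested with first derivatives of
  \<open>\<phi>\<close> moves the remaining derivative over. The two minus signs cancel.\<close>

lemma weak_solution_laplacian:
  fixes D :: "(real^'n) set" and w u :: "real^'n \<Rightarrow> real^'m" and e :: "real^'m"
  defines "d \<equiv> \<lambda>\<phi> (j::'n) x. frechet_derivative \<phi> (at x) (axis j 1)"
  assumes D: "open D" "bounded D" and f: "continuous_on {0..} f"
    and sol: "weak_solution D f w" and rep: "C1_representative D w u"
    and \<phi>: "\<phi> \<in> test_functions D"
  shows "(\<Sum>j\<in>UNIV. \<integral>x. (u x \<bullet> e) * d (d \<phi> j) j x \<partial>lebesgue_on D)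
    = (\<integral>x. (system_rhs f u x \<bullet> e) * \<phi> x \<partial>lebesgue_on D)"
proof -
  let ?M = "lebesgue_on D"
  obtain G where w2: "L2_on D w" and G2: "L2_on D G" and wg: "weak_gradient_on D w G"
    and weq: "\<And>\<Phi>. \<Phi> \<in> test_functions D \<Longrightarrow>
       (\<integral>x. G x \<bullet> matrix (frechet_derivative \<Phi> (at x)) \<partial>?M) = - (\<integral>x. system_rhs f w x \<bullet> \<Phi> x \<partial>?M)"
    using sol by (auto simp: weak_solution_def W12_with_gradient_def)
  have [measurable]: "w \<in> borel_measurable ?M" "G \<in> borel_measurable ?M"
    using w2 G2 by (auto simp: L2_on_def)
  have [measurable]: "u \<in> borel_measurable ?M"
    using C1_representative_continuous_on[OF rep] D(1)
    by (intro continuous_imp_measurable_on_sets_lebesgue) auto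
  have ae: "AE x in ?M. u x = w x" using rep by (simp add: C1_representative_def)
  have dt: "d \<psi> j \<in> test_functions D" if "\<psi> \<in> test_functions D" for \<psi> j
    unfolding d_def by (rule frechet_derivative_test_function[OF that])
  have tm: "\<psi> \<in> borel_measurable ?M" if "\<psi> \<in> test_functions D" for \<psi> :: "real^'n \<Rightarrow> real"
    using that by (intro borel_measurable_lebesgue_on test_function_borel_measurable)
  have [measurable]: "\<phi> \<in> borel_measurable ?M" "d \<phi> j \<in> borel_measurable ?M"
    "d (d \<phi> j) j \<in> borel_measurable ?M" for j
    by (intro tm dt \<phi>)+
  have [measurable]: "(\<lambda>x. w x $ i) \<in> borel_measurable ?M" for i
    using borel_measurable_inner[OF \<open>w \<in> borel_measurable ?M\<close>, of "\<lambda>_. axis i 1"]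
    by (simp add: inner_axis)
  have [measurable]: "(\<lambda>x. G x $ i $ j) \<in> borel_measurable ?M" for i j
    using borel_measurable_inner[OF \<open>G \<in> borel_measurable ?M\<close>, of "\<lambda>_. axis i (axis j 1)"]
    by (simp add: inner_axis)
  have iw: "integrable ?M (\<lambda>x. w x $ i * d (d \<phi> j) j x)" for i j
  proof (rule test_function_integrable_mult[OF dt[OF dt[OF \<phi>]]])
    show "integrable ?M (\<lambda>x. w x $ i)"
      by (rule L2_on_integrable[OF D(2,1) w2]) (auto intro: component_le_norm_cart)
  qed measurable
  have iG: "integrable ?M (\<lambda>x. G x $ i $ j * d \<phi> j x)" for i j
  proof (rule test_function_integrable_mult[OF dt[OF \<phi>]])
    have "\<bar>G x $ i $ j\<bar> \<le> norm (G x)" for x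
      using component_le_norm_cart[of "G x $ i" j] Finite_Cartesian_Product.norm_nth_le[of "G x" i]
      by linarith
    then show "integrable ?M (\<lambda>x. G x $ i $ j)"
      by (intro L2_on_integrable[OF D(2,1) G2]) auto
  qed measurable
  have grad: "(\<integral>x. G x $ i $ j * d \<phi> j x \<partial>?M) = - (\<integral>x. w x $ i * d (d \<phi> j) j x \<partial>?M)" for i j
    using wg dt[OF \<phi>, of j] unfolding weak_gradient_on_def d_def by force
  have fd: "frechet_derivative (\<lambda>x. \<phi> x *\<^sub>R e) (at x) = (\<lambda>h. frechet_derivative \<phi> (at x) h *\<^sub>R e)" for x
    by (rule frechet_derivative_at[symmetric])
      (auto intro!: derivative_eq_intros test_function_has_derivative[OF \<phi>])
  have "G x \<bullet> matrix (frechet_derivative (\<lambda>x. \<phi> x *\<^sub>R e) (at x))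
      = (\<Sum>i\<in>UNIV. \<Sum>j\<in>UNIV. e $ i * (G x $ i $ j * d \<phi> j x))" for x
    unfolding fd by (simp add: inner_vec_def matrix_def d_def mult.commute mult.left_commute)
  then have "- (\<integral>x. system_rhs f w x \<bullet> (\<phi> x *\<^sub>R e) \<partial>?M)
      = (\<integral>x. (\<Sum>i\<in>UNIV. \<Sum>j\<in>UNIV. e $ i * (G x $ i $ j * d \<phi> j x)) \<partial>?M)"
    using weq[OF test_function_scaleR_const[OF \<phi>, of e]] by simp
  also have "\<dots> = (\<Sum>i\<in>UNIV. \<Sum>j\<in>UNIV. e $ i * (\<integral>x. G x $ i $ j * d \<phi> j x \<partial>?M))"
    using iG by simp
  also have "\<dots> = (\<Sum>j\<in>UNIV. \<Sum>i\<in>UNIV. - (e $ i * (\<integral>x. w x $ i * d (d \<phi> j) j x \<partial>?M)))"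
    by (subst sum.swap) (simp add: grad)
  also have "\<dots> = - (\<Sum>j\<in>UNIV. \<integral>x. (\<Sum>i\<in>UNIV. e $ i * (w x $ i * d (d \<phi> j) j x)) \<partial>?M)"
    using iw by (simp add: sum_negf)
  also have "\<dots> = - (\<Sum>j\<in>UNIV. \<integral>x. (w x \<bullet> e) * d (d \<phi> j) j x \<partial>?M)"
  proof -
    have "(\<Sum>i\<in>UNIV. e $ i * (w x $ i * t)) = (w x \<bullet> e) * t" for x t
      by (simp add: inner_vec_def sum_distrib_left mult_ac)
    then show ?thesis by simp
  qed
  \<comment> \<open>From here the Sobolev function \<open>w\<close> is exchanged for its continuous
    representative \<open>u\<close>, equal to it almost everywhere.\<close>
  also have "\<dots> = - (\<Sum>j\<in>UNIV. \<integral>x. (u x \<bullet> e) * d (d \<phi> j) j x \<partial>?M)"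
  proof -
    have "(\<integral>x. (w x \<bullet> e) * d (d \<phi> j) j x \<partial>?M) = (\<integral>x. (u x \<bullet> e) * d (d \<phi> j) j x \<partial>?M)" for j
      by (rule integral_cong_AE; measurable?) (use ae in \<open>eventually_elim, simp\<close>)
    then show ?thesis by simp
  qed
  finally have "(\<Sum>j\<in>UNIV. \<integral>x. (u x \<bullet> e) * d (d \<phi> j) j x \<partial>?M)
      = (\<integral>x. system_rhs f w x \<bullet> (\<phi> x *\<^sub>R e) \<partial>?M)" by simp
  also have "\<dots> = (\<integral>x. (system_rhs f u x \<bullet> e) * \<phi> x \<partial>?M)"
  proof (rule integral_cong_AE)
    have [measurable]: "system_rhs f w \<in> borel_measurable ?M" "system_rhs f u \<in> borel_measurable ?M"
      using f by (auto intro: borel_measurable_system_rhs)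
    show "(\<lambda>x. system_rhs f w x \<bullet> (\<phi> x *\<^sub>R e)) \<in> borel_measurable ?M"
      "(\<lambda>x. (system_rhs f u x \<bullet> e) * \<phi> x) \<in> borel_measurable ?M"
      by measurable
    show "AE x in ?M. system_rhs f w x \<bullet> (\<phi> x *\<^sub>R e) = (system_rhs f u x \<bullet> e) * \<phi> x"
      using ae by eventually_elim (simp add: system_rhs_def indicator_def)
  qed
  finally show ?thesis .
qed

text \<open>Strict smallness on the closed ball makes |u| - c|x - y|^2 negative on the sphere, while
  it is positive at \<open>y\<close>; so the maximum is interior and \<open>u\<close> is nonzero
  there.\<close>

lemma weak_solution_nondegenerate_on_cball:
  fixes D :: "(real^'n) set" and w u :: "real^'n \<Rightarrow> real^'m" and y :: "real^'n"
  assumes D: "open D" "bounded D" and F: "structural_assumptions F"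
    and sol: "weak_solution D (half_deriv F) w" and rep: "C1_representative D w u"
    and s: "0 < s" "cball y s \<subseteq> D" and y: "u y \<noteq> 0"
    and small: "\<And>x. x \<in> cball y s \<Longrightarrow> norm (u x) < c * s\<^sup>2"
  shows "half_deriv F 0 \<le> 2 * real CARD('n) * c"
proof (rule field_le_mult_one_interval)
  \<comment> \<open>Near the touching point \<open>u x \<bullet> e\<close> is only almost
    \<open>norm (u x)\<close>, so the bound is proved with a factor \<open>\<theta> < 1\<close>, and
    \<open>\<theta>\<close> then tends to 1.\<close>
  fix \<theta> :: real assume \<theta>: "0 < \<theta>" "\<theta> < 1"
  let ?f = "half_deriv F"
  note f = structural_half_deriv[OF F]
  have uc: "continuous_on D u" using rep by (rule C1_representative_continuous_on)
  have "0 < c * s\<^sup>2" using le_less_trans[OF norm_ge_zero small[of y]] s(1) by simp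
  then have c: "0 < c" using s(1) by (simp add: zero_less_mult_iff)
  define h where "h x = norm (u x) - c * (norm (x - y))\<^sup>2" for x
  have "continuous_on (cball y s) h"
    unfolding h_def by (intro continuous_intros continuous_on_subset[OF uc s(2)])
  then obtain x1 where x1: "x1 \<in> cball y s" and max: "\<And>x. x \<in> cball y s \<Longrightarrow> h x \<le> h x1"
    using continuous_attains_sup[of "cball y s" h] s(1) by auto
  have "0 < h y" using y by (simp add: h_def)
  then have hpos: "0 < h x1" using max[of y] s(1) by simp
  have x1b: "x1 \<in> ball y s"
  proof (rule ccontr)
    assume "x1 \<notin> ball y s"
    then have "norm (x1 - y) = s" using x1 by (simp add: dist_norm norm_minus_commute)
    then show False using small[OF x1] hpos by (simp add: h_def)
  qed
  have upos: "0 < norm (u x1)"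
    using hpos mult_nonneg_nonneg[OF less_imp_le[OF c] zero_le_power2[of "norm (x1 - y)"]]
    unfolding h_def by linarith
  define e where "e = u x1 /\<^sub>R norm (u x1)"
  have ne: "norm e = 1" using upos by (simp add: e_def)
  have ue: "u x1 \<bullet> e = norm (u x1)"
    using upos by (simp add: e_def dot_square_norm power2_eq_square)
  \<comment> \<open>At \<open>x1\<close> this function equals
    \<open>(1 - \<theta>) * norm (u x1) > 0\<close>, so it stays positive on a small ball; this also
    keeps \<open>u\<close> nonzero there.\<close>
  have "continuous_on (ball y s) (\<lambda>x. u x \<bullet> e - \<theta> * norm (u x))"
    using s(2) by (intro continuous_intros continuous_on_subset[OF uc]) auto
  then have "open (ball y s \<inter> (\<lambda>x. u x \<bullet> e - \<theta> * norm (u x)) -` {0<..})"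
    by (rule continuous_open_preimage) auto
  moreover have "x1 \<in> ball y s \<inter> (\<lambda>x. u x \<bullet> e - \<theta> * norm (u x)) -` {0<..}"
    using x1b ue upos \<theta> by simp
  ultimately obtain \<rho> where \<rho>: "0 < \<rho>"
    "ball x1 \<rho> \<subseteq> ball y s \<inter> (\<lambda>x. u x \<bullet> e - \<theta> * norm (u x)) -` {0<..}"
    by (meson openE)
  have B: "x \<in> cball y s" "\<theta> * norm (u x) < u x \<bullet> e" if "x \<in> ball x1 \<rho>" for x
    using subsetD[OF \<rho>(2) that] by auto
  have BD: "ball x1 \<rho> \<subseteq> D" using B(1) s(2) by blast
  have unz: "norm (u x) \<noteq> 0" if "x \<in> ball x1 \<rho>" for x
    using B(2)[OF that] by auto
  have uB: "continuous_on (ball x1 \<rho>) u" using uc BD by (rule continuous_on_subset)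
  have vc: "continuous_on (ball x1 \<rho>) (\<lambda>x. u x \<bullet> e)" using uB by (intro continuous_intros)
  show "\<theta> * ?f 0 \<le> 2 * real CARD('n) * c"
  proof (rule weak_subsolution_touched_by_paraboloid[OF \<rho>(1) vc])
    fix x assume "x \<in> ball x1 \<rho>"
    \<comment> \<open>Cauchy-Schwarz gives \<open>u x \<bullet> e \<le> norm (u x)\<close> with
      equality at \<open>x1\<close>, so the scalar function inherits the maximum property of
      \<open>h\<close>.\<close>
    from max[OF B(1)[OF this]]
    show "u x \<bullet> e - c * (norm (x - y))\<^sup>2 \<le> u x1 \<bullet> e - c * (norm (x1 - y))\<^sup>2"
      using norm_cauchy_schwarz[of "u x" e] by (simp add: h_def ue ne)
  next
    fix \<phi> :: "real^'n \<Rightarrow> real"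
    assume \<phi>: "\<phi> \<in> test_functions (ball x1 \<rho>)" and nonneg: "\<And>x. 0 \<le> \<phi> x"
    let ?d = "\<lambda>j x. frechet_derivative (\<lambda>x. frechet_derivative \<phi> (at x) (axis j 1)) (at x) (axis j 1)"
    \<comment> \<open>The component of the right-hand side along \<open>e\<close>, without the
      indicator: \<open>u\<close> has no zeros on this ball, so \<open>g\<close> is continuous
      there.\<close>
    define g where "g x = ?f (norm (u x)) * ((u x \<bullet> e) / norm (u x))" for x
    have gc: "continuous_on (ball x1 \<rho>) g"
      unfolding g_def using unz
      by (intro continuous_intros uB continuous_on_compose2[OF f(1)]) auto
    have ge: "\<theta> * ?f 0 \<le> g x" if "x \<in> ball x1 \<rho>" for x
    proof -
      have "\<theta> \<le> (u x \<bullet> e) / norm (u x)"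
        using B(2)[OF that] unz[OF that] by (simp add: le_divide_eq)
      then have "?f 0 * \<theta> \<le> g x"
        unfolding g_def using \<theta> f(2) f(3)[of "norm (u x)"] by (intro mult_mono) auto
      then show ?thesis by (simp add: mult.commute)
    qed
    have dt: "?d j \<in> test_functions (ball x1 \<rho>)" for j
      by (intro frechet_derivative_test_function \<phi>)
    have "\<theta> * ?f 0 * (\<integral>x. \<phi> x \<partial>lborel) = (\<integral>x. \<theta> * ?f 0 * \<phi> x \<partial>lborel)" by simp
    also have "\<dots> \<le> (\<integral>x. g x * \<phi> x \<partial>lborel)"
    proof (rule integral_mono)
      show "integrable lborel (\<lambda>x. \<theta> * ?f 0 * \<phi> x)"
        using integrable_test_function[OF \<phi>] by simp
      show "integrable lborel (\<lambda>x. g x * \<phi> x)"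
        by (rule integrable_mult_test_function[OF \<phi> gc])
      show "\<theta> * ?f 0 * \<phi> x \<le> g x * \<phi> x" for x
        using ge[of x] nonneg[of x] test_function_eq_0[OF \<phi>, of x]
        by (cases "x \<in> ball x1 \<rho>") (auto intro: mult_right_mono)
    qed
    also have "\<dots> = (\<integral>x. g x * \<phi> x \<partial>lebesgue_on D)"
      by (rule integral_lebesgue_on_mult_test_function[OF D(1) BD gc \<phi>, symmetric])
    also have "\<dots> = (\<integral>x. (system_rhs ?f u x \<bullet> e) * \<phi> x \<partial>lebesgue_on D)"
    proof (intro Bochner_Integration.integral_cong refl)
      fix x
      show "g x * \<phi> x = (system_rhs ?f u x \<bullet> e) * \<phi> x"
        using unz[of x] test_function_eq_0[OF \<phi>, of x]
        by (cases "x \<in> ball x1 \<rho>") (auto simp: g_def system_rhs_def divide_inverse)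
    qed
    also have "\<dots> = (\<Sum>j\<in>UNIV. \<integral>x. (u x \<bullet> e) * ?d j x \<partial>lebesgue_on D)"
      using weak_solution_laplacian[OF D f(1) sol rep, of \<phi> e] \<phi> test_functions_mono[OF BD] by auto
    also have "\<dots> = (\<Sum>j\<in>UNIV. \<integral>x. (u x \<bullet> e) * ?d j x \<partial>lborel)"
      by (intro sum.cong refl integral_lebesgue_on_mult_test_function[OF D(1) BD vc dt])
    also have "\<dots> = (\<integral>x. (u x \<bullet> e) * laplacian \<phi> x \<partial>lborel)"
      unfolding laplacian_def sum_distrib_left
      by (intro Bochner_Integration.integral_sum[symmetric] integrable_mult_test_function[OF dt vc])
    finally show "\<theta> * ?f 0 * (\<integral>x. \<phi> x \<partial>lborel) \<le> (\<integral>x. (u x \<bullet> e) * laplacian \<phi> x \<partial>lborel)" .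
  qed
qed

text \<open>\<open>w\<close> stands for the Sobolev solution, \<open>u\<close> for its C1
  representative. The supremum is an \<open>ereal\<close> because |u| need not be bounded on the
  open ball, whose closure may leave \<open>D\<close>.\<close>

theorem proposition2p2:
  fixes D :: "(real^'n) set" and F :: "real \<Rightarrow> real"
    and w u :: "real^'n \<Rightarrow> real^'m" and x0 :: "real^'n" and r :: real
  assumes "CARD('n) \<ge> 2"
    and "bounded_Lipschitz_domain D"
    and "structural_assumptions F"
    and "weak_solution D (half_deriv F) w"
    and "C1_representative D w u"
    and "x0 \<in> closure {x \<in> D. norm (u x) > 0}"
    and "r > 0" and "ball x0 r \<subseteq> D"
  shows "(SUP x \<in> ball x0 r. ereal (norm (u x)))
           \<ge> ereal (half_deriv F 0 / (2 * real CARD('n)) * r\<^sup>2)"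
proof (rule ccontr)
  let ?N = "2 * real CARD('n)"
  let ?k = "half_deriv F 0 / ?N"
  have D: "open D" "bounded D"
    using assms(2) by (auto simp: bounded_Lipschitz_domain_def)
  assume "\<not> ?thesis"
  then have "(SUP x \<in> ball x0 r. ereal (norm (u x))) < ereal (?k * r\<^sup>2)"
    by (simp only: not_le)
  \<comment> \<open>The strict gap is spent three times: \<open>b\<close> lies above the supremum,
    \<open>c\<close> below the constant \<open>?k\<close>, and the radius \<open>s\<close> below
    \<open>r\<close>, in such a way that \<open>b < c * s\<^sup>2\<close> still holds.\<close>
  then obtain b where b: "(SUP x \<in> ball x0 r. ereal (norm (u x))) < ereal b" "b < ?k * r\<^sup>2"
    using ereal_dense2 less_ereal.simps(1) by blast
  have ub: "norm (u x) < b" if "x \<in> ball x0 r" for x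
    using le_less_trans[OF SUP_upper[OF that, of "\<lambda>x. ereal (norm (u x))"] b(1)] by simp
  have "0 < b" using le_less_trans[OF norm_ge_zero ub[of x0]] assms(7) by simp
  have "b / r\<^sup>2 < ?k" using b(2) assms(7) by (simp add: divide_less_eq)
  then obtain c where c: "b / r\<^sup>2 < c" "c < ?k" using dense by blast
  have c0: "0 < c" using less_trans[OF _ c(1), of 0] \<open>0 < b\<close> assms(7) by simp
  have "b / c < r\<^sup>2" using c(1) c0 assms(7) by (simp add: field_simps)
  then have "sqrt (b / c) < r" using assms(7) by (intro real_less_lsqrt) auto
  then obtain s where s: "sqrt (b / c) < s" "s < r" using dense by blast
  have s0: "0 < s" using le_less_trans[OF real_sqrt_ge_zero s(1)] \<open>0 < b\<close> c0 by simp
  have "b / c < s\<^sup>2" using power_strict_mono[OF s(1), of 2] \<open>0 < b\<close> c0 by simp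
  then have bs: "b < c * s\<^sup>2" using c0 by (simp add: field_simps)
  \<comment> \<open>\<open>x0\<close> lies only in the closure, so it is replaced by a nearby point
    with \<open>u y \<noteq> 0\<close>; the margin \<open>r - s\<close> keeps
    \<open>cball y s\<close> inside the original ball.\<close>
  obtain y where y: "y \<in> D" "0 < norm (u y)" "dist y x0 < r - s"
    using closure_approachable[THEN iffD1, OF assms(6), rule_format, of "r - s"] s(2) by auto
  have sub: "cball y s \<subseteq> ball x0 r"
  proof
    fix x assume "x \<in> cball y s"
    then show "x \<in> ball x0 r"
      using y(3) dist_triangle[of x0 x y] by (simp add: dist_commute)
  qed
  have "half_deriv F 0 \<le> ?N * c"
  proof (rule weak_solution_nondegenerate_on_cball[OF D assms(3-5) s0])
    show "cball y s \<subseteq> D" using sub assms(8) by blast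
    show "u y \<noteq> 0" using y(2) by simp
    show "norm (u x) < c * s\<^sup>2" if "x \<in> cball y s" for x
      using less_trans[OF ub[OF subsetD[OF sub that]] bs] .
  qed
  then have "?k \<le> c" by (simp add: divide_le_eq mult.commute)
  then show False using c(2) by simp
qed

end
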